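(* Let $n\ge2$ and suppose that $\Omega\in L^s(\mathbf{S}^{n-1})$ with $1<s\leq\infty$, where $\Omega$ is homogeneous of degree zero on $\mathbb R^n$. Let $0<\lambda<n$, $s'<p,q<\infty$ and $1/p+1/q+\lambda/n=2$. Then there exists a constant $C>0$ such that for any $f\in L^p(\mathbb R^n)$ and $g\in L^q(\mathbb R^n)$ ($C$ being independent of $f$ and $g$), $$\bigg|\int_{\mathbb R^n}\int_{\mathbb R^n}\frac{\Omega(x-y)f(x)\, g(y)}{|x-y|^{\lambda}}\,dx\,dy\bigg|\leq C\|f\|_{L^p}\|g\|_{L^q}.$$
   Context: $\mathbf{S}^{n-1}$ is the unit sphere of $\mathbb R^n$ with normalized Lebesgue measure; $1/s+1/s'=1$ ($s'=1$ if $s=\infty$). *)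

theory Defs
  imports "HOL-Analysis.Analysis"
begin

definition Lp_space :: "ereal \<Rightarrow> 'a measure \<Rightarrow> ('a \<Rightarrow> 'b::{banach, second_countable_topology}) set"
  where "Lp_space p M = {f \<in> borel_measurable M.
    if p = \<infinity> then (\<exists>c. AE x in M. norm (f x) \<le> c)
    else integrable M (\<lambda>x. norm (f x) powr real_of_ereal p)}"

definition Lp_norm :: "real \<Rightarrow> 'a measure \<Rightarrow> ('a \<Rightarrow> 'b::real_normed_vector) \<Rightarrow> real"
  where "Lp_norm p M f = (LINT x|M. norm (f x) powr p) powr (1 / p)"

text \<open>
  The normalized Lebesgue (surface) measure on the unit sphere, with the Borel subsets of the
  sphere as measurable sets. The measure of \<open>A\<close> is the proportion of the volume of the unit ball
  that lies in the cone \<open>{r *\<^sub>R x | r x. 0 < r \<and> r < 1 \<and> x \<in> A}\<close>; here \<open>sgn x\<close> is \<open>x /\<^sub>R norm x\<close>,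
  and the origin is removed so that \<open>sgn\<close> maps into the sphere.
\<close>

definition sphere_measure :: "'a::euclidean_space measure"
  where "sphere_measure =
    distr (uniform_measure (restrict_space lborel (- {0})) (ball 0 1 - {0}))
      (restrict_space borel (sphere 0 1)) sgn"

lemma sgn_measurable_sphere:
  "sgn \<in> restrict_space borel (- {0}) \<rightarrow>\<^sub>M restrict_space borel (sphere (0::'a::euclidean_space) 1)"
proof (rule measurable_restrict_space3)
  show "(sgn :: 'a \<Rightarrow> 'a) \<in> borel \<rightarrow>\<^sub>M borel"
    unfolding sgn_div_norm by measurable
qed (auto simp: norm_sgn)

lemma space_sphere_measure: "space sphere_measure = sphere 0 1"
  by (simp add: sphere_measure_def space_restrict_space)

lemma sets_sphere_measure: "sets sphere_measure = sets (restrict_space borel (sphere 0 1))"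
  by (simp add: sphere_measure_def)

lemma emeasure_sphere_measure:
  fixes A :: "'a::euclidean_space set"
  assumes "A \<in> sets sphere_measure"
  shows "emeasure sphere_measure A =
    emeasure lborel {x \<in> ball 0 1. sgn x \<in> A} / emeasure lborel (ball (0::'a) 1)"
proof -
  let ?R = "restrict_space lborel (- {0::'a})"
  have R: "sets ?R = sets (restrict_space borel (- {0::'a}))" 
    by (simp add: sets_restrict_space)
  have A: "A \<in> sets (restrict_space borel (sphere 0 1))"
    using assms by (simp add: sets_sphere_measure)
  have A0: "0 \<notin> A"
    using sets.sets_into_space[OF assms] by (auto simp: space_sphere_measure)
  have meas: "sgn \<in> uniform_measure ?R (ball 0 1 - {0}) \<rightarrow>\<^sub>M restrict_space borel (sphere (0::'a) 1)"
    using sgn_measurable_sphere[where 'a='a]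
    by (subst measurable_cong_sets[OF _ refl, where M' = "restrict_space borel (- {0})"]) (simp_all add: R)
  have ball: "ball 0 1 - {0::'a} \<in> sets ?R"
    by (auto simp: sets_restrict_space)
  have pre: "sgn -` A \<inter> - {0} \<in> sets ?R"
    using measurable_sets[OF meas A] by (simp add: space_restrict_space)
  have "emeasure ?R (ball 0 1 - {0}) = emeasure lborel (ball (0::'a) 1 - {0})"
    by (subst emeasure_restrict_space) auto
  also have "\<dots> = emeasure lborel (ball (0::'a) 1)"
    by (rule emeasure_Diff_null_set) auto
  finally have 1: "emeasure ?R (ball 0 1 - {0}) = emeasure lborel (ball (0::'a) 1)" .
  have eq: "(ball 0 1 - {0}) \<inter> (sgn -` A \<inter> - {0}) = {x \<in> ball 0 1. sgn x \<in> A}"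
    using A0 by auto
  have 2: "emeasure ?R {x \<in> ball 0 1. sgn x \<in> A} = emeasure lborel {x \<in> ball 0 1. sgn x \<in> A}"
    using A0 by (subst emeasure_restrict_space) auto
  have "emeasure sphere_measure A =
      emeasure (uniform_measure ?R (ball 0 1 - {0})) (sgn -` A \<inter> - {0})"
    unfolding sphere_measure_def
    by (subst emeasure_distr[OF meas A]) (simp add: space_restrict_space)
  also have "\<dots> = emeasure lborel {x \<in> ball 0 1. sgn x \<in> A} / emeasure lborel (ball (0::'a) 1)"
    using emeasure_uniform_measure[OF ball pre] unfolding eq 1 2 .
  finally show ?thesis .
qed

lemma prob_sphere_measure: "emeasure sphere_measure (sphere (0::'a::euclidean_space) 1) = 1"
proof -
  have "emeasure lborel {x \<in> ball 0 1. sgn x \<in> sphere (0::'a) 1} = emeasure lborel (ball (0::'a) 1 - {0})"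
    by (rule arg_cong[where f = "emeasure lborel"]) (auto simp: norm_sgn split: if_splits)
  also have "\<dots> = emeasure lborel (ball (0::'a) 1)"
    by (rule emeasure_Diff_null_set) auto
  finally have 1: "emeasure lborel {x \<in> ball 0 1. sgn x \<in> sphere (0::'a) 1} = emeasure lborel (ball (0::'a) 1)" .
  have "sphere (0::'a) 1 \<in> sets sphere_measure"
    using sets.top[of "sphere_measure :: 'a measure"] by (simp add: space_sphere_measure)
  moreover have "emeasure lborel (ball (0::'a) 1) \<noteq> 0"
    using content_ball_pos[of 1 "0::'a"] by (auto simp: measure_def)
  moreover have "emeasure lborel (ball (0::'a) 1) \<noteq> top"
    using emeasure_lborel_ball_finite[of "0::'a" 1] by simp
  ultimately show ?thesis
    unfolding less_top by (metis 1 emeasure_sphere_measure ennreal_divide_self)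
qed

text \<open>Rotation invariance, which together with total mass 1 characterizes the measure. The sort constraint is that of
  the change-of-variables lemmas in the library.\<close>

lemma emeasure_sphere_measure_orthogonal_image:
  fixes f :: "real ^ 'n::{finite,wellorder} \<Rightarrow> real ^ 'n::_"
  assumes f: "orthogonal_transformation f" and A: "A \<in> sets sphere_measure"
  shows "emeasure sphere_measure (f ` A) = emeasure sphere_measure A"
proof -
  let ?K = "\<lambda>A. {x \<in> ball 0 1. sgn x \<in> A} :: (real ^ 'n::_) set"
  have sets_iff: "B \<in> sets sphere_measure \<longleftrightarrow> B \<in> sets borel \<and> B \<subseteq> sphere 0 1" for B :: "(real ^ 'n::_) set"
    by (auto simp: sets_sphere_measure sets_restrict_space_iff)
  have norm_f: "norm (f x) = norm x" for x
    using f by (simp add: orthogonal_transformation_norm)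
  have lin: "linear f" and bij: "bij f"
    using f by (simp_all add: orthogonal_transformation_linear orthogonal_transformation_bij)
  have sgn_f: "sgn (f x) = f (sgn x)" for x
    by (simp add: sgn_div_norm norm_f linear_scale[OF lin])
  have "inv f \<in> borel_measurable borel"
    by (intro borel_measurable_continuous_onI linear_continuous_on linear_conv_bounded_linear[THEN iffD1]
        orthogonal_transformation_linear orthogonal_transformation_inv f)
  then have "inv f -` A \<in> sets borel"
    using A measurable_sets_borel[of "inv f" borel A] by (simp add: sets_iff)
  then have fA: "f ` A \<in> sets sphere_measure"
    using A by (auto simp: sets_iff bij_image_Collect_eq[OF bij] bij_vimage_eq_inv_image[OF bij] norm_f
        bij_vimage_eq_inv_image[OF bij_imp_bij_inv[OF bij]] inv_inv_eq[OF bij])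
  have K: "f ` ?K A = ?K (f ` A)"
  proof -
    have "x \<in> f ` ?K A" if "x \<in> ?K (f ` A)" for x
    proof -
      obtain y where y: "x = f y" using bij by (metis bij_pointE)
      have "f (sgn y) \<in> f ` A" "norm y < 1" using that by (auto simp: y sgn_f norm_f)
      then have "y \<in> ?K A" using bij by (auto simp: bij_def inj_def)
      then show ?thesis by (simp add: y)
    qed
    then show ?thesis by (auto simp: sgn_f norm_f)
  qed
  have Kborel: "?K B \<in> sets borel" if "B \<in> sets sphere_measure" for B
  proof -
    have "(sgn :: real ^ 'n::_ \<Rightarrow> _) \<in> borel_measurable borel"
      unfolding sgn_div_norm by measurable
    then have "sgn -` B \<in> sets borel"
      using that measurable_sets_borel[of sgn borel B] by (simp add: sets_iff)
    then have "ball 0 1 \<inter> sgn -` B \<in> sets borel" by auto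
    then show ?thesis by (simp add: vimage_def Int_def)
  qed
  have Klm: "?K B \<in> lmeasurable" if "B \<in> sets sphere_measure" for B
    using Kborel[OF that] by (intro bounded_set_imp_lmeasurable bounded_subset[OF bounded_ball[of 0 1]]) auto
  have em: "emeasure lborel (?K B) = ennreal (measure lebesgue (?K B))" if "B \<in> sets sphere_measure" for B
    using emeasure_eq_measure2[OF Klm[OF that]] Kborel[OF that] by simp
  have "emeasure lborel (?K (f ` A)) = emeasure lborel (?K A)"
    using em[OF fA] em[OF A] measure_orthogonal_image[OF f Klm[OF A]] unfolding K by simp
  then show ?thesis
    by (simp only: emeasure_sphere_measure[OF fA] emeasure_sphere_measure[OF A])
qed

end

theory Submission
  imports Defs
begin

text \<open>
  Write \<open>r = n / \<lambda>\<close>, so that \<open>1 / p + 1 / q + 1 / r = 2\<close>. The conditions \<open>s' < p\<close> and \<open>s' < q\<close> force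
  \<open>1 / r > 2 / s\<close>, hence \<open>r < s\<close>; cutting \<open>\<Omega>\<close> at dyadic heights then shows that the kernel
  \<open>\<bar>\<Omega> z\<bar> / \<bar>z\<bar>\<^sup>\<lambda>\<close> is in weak \<open>L\<^sup>r\<close>, and the claim becomes the weak Young inequality.

  For the latter, normalize \<open>f\<close> and \<open>g\<close> and split the double integral according to whether
  \<open>g(y)\<^sup>q \<le> f(x)\<^sup>p\<close> or not. In the first region the integral over \<open>y\<close> involves only \<open>g\<close> truncated at
  height \<open>B = f(x)\<^sup>p\<^sup>/\<^sup>q\<close> against a weak \<open>L\<^sup>r\<close> function, and Chebyshev's bound for \<open>g\<close> is enough to
  estimate it by a multiple of \<open>f(x)\<^sup>p\<^sup>-\<^sup>1\<close>, since \<open>1 / q + 1 / r > 1\<close>. The integral over \<open>x\<close> is then a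
  multiple of \<open>\<parallel>f\<parallel>\<^sub>p\<^sup>p\<close>. The other region is symmetric.
\<close>

section \<open>Weak integrability\<close>

text \<open>Each of the layer decompositions below picks its layer index with this lemma, applied to
  a value divided by its threshold.\<close>

lemma dyadic_interval:
  fixes y :: real
  assumes "1 \<le> y"
  obtains k :: nat where "2 ^ k \<le> y" "y < 2 ^ Suc k"
proof -
  have ex: "\<exists>k::nat. y < 2 ^ k"
    using real_arch_pow[of 2 y] by auto
  define m where "m = (LEAST k::nat. y < 2 ^ k)"
  have m: "y < 2 ^ m"
    unfolding m_def using ex by (rule LeastI_ex)
  with assms obtain k where k: "m = Suc k"
    by (cases m) auto
  have "\<not> y < 2 ^ k"
    using not_less_Least[of k "\<lambda>k. y < 2 ^ k"] k unfolding m_def by auto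
  with m k show ?thesis by (intro that[of k]) auto
qed

lemma nn_integral_suminf_geometric_le:
  fixes \<phi> :: "nat \<Rightarrow> 'a \<Rightarrow> ennreal"
  assumes "\<And>k. \<phi> k \<in> borel_measurable M"
    and le: "\<And>k. (\<integral>\<^sup>+x. \<phi> k x \<partial>M) \<le> ennreal (a * z ^ k)"
    and "0 \<le> a" "0 \<le> z" "z < 1"
  shows "(\<integral>\<^sup>+x. (\<Sum>k. \<phi> k x) \<partial>M) \<le> ennreal (a / (1 - z))"
proof -
  have "(\<integral>\<^sup>+x. (\<Sum>k. \<phi> k x) \<partial>M) = (\<Sum>k. \<integral>\<^sup>+x. \<phi> k x \<partial>M)"
    using assms(1) by (rule nn_integral_suminf)
  also have "\<dots> \<le> (\<Sum>k. ennreal (a * z ^ k))"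
    by (intro suminf_le le) auto
  also have "\<dots> = ennreal (\<Sum>k. a * z ^ k)"
    using assms by (intro suminf_ennreal2) (auto intro!: summable_mult summable_geometric)
  also have "(\<Sum>k. a * z ^ k) = a / (1 - z)"
    using assms by (simp add: suminf_mult summable_geometric suminf_geometric)
  finally show ?thesis .
qed

lemma suminf_ge_term_ennreal: "f k \<le> (\<Sum>k. f k)" for f :: "nat \<Rightarrow> ennreal"
  using sum_le_suminf[of f "{k}"] by auto

section \<open>Chebyshev's inequality and weak-type bounds\<close>

lemma emeasure_superlevel_le_powr:
  assumes [measurable]: "u \<in> borel_measurable M" and "0 < t" "0 < p" "0 \<le> N"
    and N: "(\<integral>\<^sup>+x. ennreal (\<bar>u x\<bar> powr p) \<partial>M) \<le> ennreal N"
  shows "emeasure M {x \<in> space M. t \<le> u x} \<le> ennreal (N * t powr - p)"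
proof -
  have "emeasure M {x \<in> space M. t \<le> u x}
      \<le> emeasure M {x \<in> space M. 1 \<le> ennreal (t powr - p) * ennreal (\<bar>u x\<bar> powr p)}"
  proof (rule emeasure_mono)
    have "1 \<le> t powr - p * \<bar>u x\<bar> powr p" if "t \<le> u x" for x
    proof -
      have "t powr p \<le> \<bar>u x\<bar> powr p"
        using that assms by (intro powr_mono2) auto
      then show ?thesis using assms by (simp add: powr_minus field_simps)
    qed
    then show "{x \<in> space M. t \<le> u x}
      \<subseteq> {x \<in> space M. 1 \<le> ennreal (t powr - p) * ennreal (\<bar>u x\<bar> powr p)}"
      by (auto simp: ennreal_mult[symmetric] ennreal_1[symmetric] simp del: ennreal_1
          intro!: ennreal_leI)
  qed auto
  also have "\<dots> \<le> ennreal (t powr - p) * (\<integral>\<^sup>+x. ennreal (\<bar>u x\<bar> powr p) * indicator (space M) x \<partial>M)"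
    by (rule nn_integral_Markov_inequality) auto
  also have "(\<integral>\<^sup>+x. ennreal (\<bar>u x\<bar> powr p) * indicator (space M) x \<partial>M) = (\<integral>\<^sup>+x. ennreal (\<bar>u x\<bar> powr p) \<partial>M)"
    by (rule nn_integral_cong) auto
  also have "ennreal (t powr - p) * \<dots> \<le> ennreal (t powr - p) * ennreal N"
    by (intro mult_left_mono N) auto
  also have "\<dots> = ennreal (N * t powr - p)"
    using assms by (simp add: ennreal_mult[symmetric] mult.commute)
  finally show ?thesis .
qed

text \<open>For nonnegative \<open>h\<close> this is membership in weak \<open>L^r\<close>, with
  \<open>A\<close> bounding the \<open>r\<close>-th power of the quasi-norm. Keeping that power
  makes the bound linear in the measure of the superlevel set.\<close>

definition weak_bound :: "'a measure \<Rightarrow> ('a \<Rightarrow> real) \<Rightarrow> real \<Rightarrow> real \<Rightarrow> bool" where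
  "weak_bound M h A r \<longleftrightarrow>
    (\<forall>c>0. emeasure M {x \<in> space M. c \<le> h x} \<le> ennreal (A * c powr - r))"

text \<open>The summand 1 pays for the part of \<open>h\<close> below the cutting height, the
  quotient for the geometric series of dyadic layers above it.\<close>

definition weak_const :: "real \<Rightarrow> real \<Rightarrow> real" where
  "weak_const A r = 1 + 2 * A / (1 - 2 powr (1 - r))"

lemma two_powr_less_1: "(2::real) powr a < 1" if "a < 0"
  using powr_less_cancel_iff[of 2 a 0] that by simp

lemma weak_const_pos: "0 \<le> A \<Longrightarrow> 1 < r \<Longrightarrow> 0 < weak_const A r"
  using two_powr_less_1[of "1 - r"] by (auto simp: weak_const_def intro!: add_pos_nonneg)

text \<open>Kolmogorov's inequality. Below a height \<open>t\<close> the integral over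
  \<open>E\<close> is at most \<open>t * m\<close>. Above it the \<open>k\<close>-th dyadic layer
  contributes at most \<open>2 * A * (2 ^ k * t) powr (1 - r)\<close>, which is summable because
  \<open>r > 1\<close>.\<close>

lemma weak_bound_nn_integral_le:
  fixes h :: "'a \<Rightarrow> real"
  assumes [measurable]: "h \<in> borel_measurable M" "E \<in> sets M"
    and h: "weak_bound M h A r" and "0 \<le> A" "1 < r"
    and m: "emeasure M E \<le> ennreal m" "0 < m"
  shows "(\<integral>\<^sup>+x. ennreal (h x) * indicator E x \<partial>M) \<le> ennreal (weak_const A r * m powr (1 - 1 / r))"
proof -
  \<comment> \<open>This height balances the two parts: \<open>t * m\<close> and
    \<open>t powr (1 - r)\<close> both equal \<open>m powr (1 - 1 / r)\<close>.\<close>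
  define t where "t = m powr (- 1 / r)"
  have t: "0 < t" using m by (simp add: t_def)
  \<comment> \<open>Twice the lower height of a layer dominates \<open>h\<close> on that layer. The
    whole superlevel set is used instead of the layer inside \<open>E\<close>, so that the weak
    bound applies directly.\<close>
  define \<phi> where "\<phi> k x = ennreal (2 * (2 ^ k * t)) * indicator {x \<in> space M. 2 ^ k * t \<le> h x} x" for k x
  have [measurable]: "\<phi> k \<in> borel_measurable M" for k
    unfolding \<phi>_def by measurable
  define z :: real where "z = 2 powr (1 - r)"
  have z: "0 < z" "z < 1"
    using assms two_powr_less_1[of "1 - r"] by (auto simp: z_def)
  have \<phi>: "(\<integral>\<^sup>+x. \<phi> k x \<partial>M) \<le> ennreal ((2 * A * t powr (1 - r)) * z ^ k)" for k
  proof -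
    have "(\<integral>\<^sup>+x. \<phi> k x \<partial>M) = ennreal (2 * (2 ^ k * t)) * emeasure M {x \<in> space M. 2 ^ k * t \<le> h x}"
      unfolding \<phi>_def by (subst nn_integral_cmult_indicator) auto
    also have "\<dots> \<le> ennreal (2 * (2 ^ k * t)) * ennreal (A * (2 ^ k * t) powr - r)"
      using h t by (intro mult_left_mono) (auto simp: weak_bound_def)
    also have "\<dots> = ennreal (2 * (2 ^ k * t) * (A * (2 ^ k * t) powr - r))"
      using t assms by (subst ennreal_mult) auto
    also have "2 * (2 ^ k * t) * (A * (2 ^ k * t) powr - r) = 2 * A * (2 ^ k * t) powr (1 - r)"
      using t by (simp add: powr_diff powr_minus field_simps)
    also have "(2 ^ k * t) powr (1 - r) = t powr (1 - r) * z ^ k"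
      using t by (simp add: powr_mult z_def powr_power powr_realpow[symmetric] powr_powr mult_ac)
    finally show ?thesis by (simp add: mult_ac)
  qed
  have "(\<integral>\<^sup>+x. ennreal (h x) * indicator E x \<partial>M)
      \<le> (\<integral>\<^sup>+x. ennreal t * indicator E x + (\<Sum>k. \<phi> k x) \<partial>M)"
  proof (rule nn_integral_mono)
    fix x assume x: "x \<in> space M"
    show "ennreal (h x) * indicator E x \<le> ennreal t * indicator E x + (\<Sum>k. \<phi> k x)"
    proof (cases "h x \<le> t")
      case True
      then have "ennreal (h x) * indicator E x \<le> ennreal t * indicator E x"
        by (intro mult_right_mono ennreal_leI) auto
      then show ?thesis by (simp add: add_increasing2)
    next
      case False
      then have "1 \<le> h x / t" using t by simp
      then obtain k where k: "2 ^ k \<le> h x / t" "h x / t < 2 ^ Suc k"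
        by (rule dyadic_interval)
      then have k': "2 ^ k * t \<le> h x" "h x \<le> 2 * (2 ^ k * t)"
        using t by (simp_all add: field_simps)
      have "ennreal (h x) * indicator E x \<le> \<phi> k x"
        using k' x by (auto simp: \<phi>_def indicator_def intro!: ennreal_leI)
      also have "\<dots> \<le> (\<Sum>k. \<phi> k x)" by (rule suminf_ge_term_ennreal)
      finally show ?thesis by (simp add: add_increasing)
    qed
  qed
  also have "\<dots> = ennreal t * emeasure M E + (\<integral>\<^sup>+x. (\<Sum>k. \<phi> k x) \<partial>M)"
    by (subst nn_integral_add) (auto simp: nn_integral_cmult_indicator)
  also have "\<dots> \<le> ennreal t * ennreal m + ennreal ((2 * A * t powr (1 - r)) / (1 - z))"
    using m z assms
    by (intro add_mono mult_left_mono nn_integral_suminf_geometric_le \<phi>) auto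
  also have "\<dots> = ennreal (t * m + (2 * A * t powr (1 - r)) / (1 - z))"
    using t m z assms by (simp add: ennreal_mult[symmetric])
  also have "t * m + (2 * A * t powr (1 - r)) / (1 - z) = weak_const A r * m powr (1 - 1 / r)"
  proof -
    have "t * m = m powr (1 - 1 / r)"
      using m powr_add[of m "- 1 / r" 1] by (simp add: t_def)
    moreover have "- 1 / r * (1 - r) = 1 - 1 / r"
      using assms by (simp add: field_simps)
    then have "t powr (1 - r) = m powr (1 - 1 / r)"
      by (simp add: t_def powr_powr)
    ultimately show ?thesis
      by (simp add: weak_const_def z_def algebra_simps)
  qed
  finally show ?thesis .
qed

text \<open>The sum of the geometric series in the next lemma, whose ratio is
  \<open>2 powr (q * (1 - 1 / r) - 1)\<close>, without the power of \<open>B\<close>.\<close>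

definition weak_prod_const :: "real \<Rightarrow> real \<Rightarrow> real \<Rightarrow> real" where
  "weak_prod_const A q r =
    weak_const A r * 2 powr (q * (1 - 1 / r)) / (1 - 2 powr (q * (1 - 1 / r) - 1))"

lemma weak_prod_const_pos:
  assumes "0 \<le> A" "1 < r" "q * (1 - 1 / r) < 1"
  shows "0 < weak_prod_const A q r"
  using assms weak_const_pos[of A r] two_powr_less_1[of "q * (1 - 1 / r) - 1"]
  by (auto simp: weak_prod_const_def)

text \<open>The layers now descend from \<open>B\<close>. Where \<open>g\<close> is comparable to
  \<open>B / 2 ^ k\<close>, it is replaced by that constant, and \<open>h\<close> is integrated by
  Kolmogorov's inequality over a set whose measure the weak bound of \<open>g\<close> controls. The
  product decays geometrically in \<open>k\<close> because
  \<open>q * (1 - 1 / r) < 1\<close>.\<close>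

lemma weak_bound_nn_integral_truncated_le:
  fixes g h :: "'a \<Rightarrow> real"
  assumes [measurable]: "g \<in> borel_measurable M" "h \<in> borel_measurable M"
    and g: "weak_bound M g 1 q" "\<And>x. 0 \<le> g x"
    and h: "weak_bound M h A r" "\<And>x. 0 \<le> h x"
    and "0 \<le> A" "1 < r" "q * (1 - 1 / r) < 1" "0 < B"
  shows "(\<integral>\<^sup>+x. ennreal (g x * h x) * indicator {x. g x \<le> B} x \<partial>M)
    \<le> ennreal (weak_prod_const A q r * B powr (1 - q * (1 - 1 / r)))"
proof -
  define \<theta> where "\<theta> = 1 - 1 / r"
  define E where "E k = {x \<in> space M. B / 2 ^ Suc k \<le> g x}" for k
  have [measurable]: "E k \<in> sets M" for k unfolding E_def by measurable
  define \<phi> where "\<phi> k x = ennreal (B / 2 ^ k) * (ennreal (h x) * indicator (E k) x)" for k x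
  have [measurable]: "\<phi> k \<in> borel_measurable M" for k
    unfolding \<phi>_def by measurable
  define z :: real where "z = 2 powr (q * \<theta> - 1)"
  have z: "0 < z" "z < 1"
    using assms two_powr_less_1[of "q * \<theta> - 1"] by (auto simp: z_def \<theta>_def)
  define a where "a = weak_const A r * 2 powr (q * \<theta>) * B powr (1 - q * \<theta>)"
  have a: "0 \<le> a"
    using assms weak_const_pos[of A r] by (simp add: a_def)
  have \<phi>: "(\<integral>\<^sup>+x. \<phi> k x \<partial>M) \<le> ennreal (a * z ^ k)" for k
  proof -
    define b where "b = B / 2 ^ Suc k"
    have b: "0 < b" using assms by (simp add: b_def)
    have "(\<integral>\<^sup>+x. \<phi> k x \<partial>M) = ennreal (B / 2 ^ k) * (\<integral>\<^sup>+x. ennreal (h x) * indicator (E k) x \<partial>M)"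
      unfolding \<phi>_def by (subst nn_integral_cmult) auto
    \<comment> \<open>Kolmogorov's inequality with \<open>m = b powr - q\<close>, which bounds the
      measure of \<open>E k\<close>.\<close>
    also have "\<dots> \<le> ennreal (B / 2 ^ k) * ennreal (weak_const A r * (b powr - q) powr (1 - 1 / r))"
      using assms g(1) b
      by (intro mult_left_mono weak_bound_nn_integral_le) (auto simp: weak_bound_def E_def b_def)
    also have "\<dots> = ennreal (B / 2 ^ k * (weak_const A r * (b powr - q) powr (1 - 1 / r)))"
      using assms weak_const_pos[of A r] by (subst ennreal_mult) auto
    also have "B / 2 ^ k * (weak_const A r * (b powr - q) powr (1 - 1 / r))
        = weak_const A r * (B / 2 ^ k * b powr (- (q * \<theta>)))"
      by (simp add: powr_powr \<theta>_def)
    also have "b powr (- (q * \<theta>)) = B powr (- (q * \<theta>)) * 2 powr (q * \<theta>) * (2 powr (q * \<theta>)) ^ k"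
    proof -
      have "2 powr - real (Suc k) = (1 / 2 ^ Suc k :: real)"
        by (subst powr_minus_divide) (simp add: powr_realpow del: of_nat_Suc power_Suc)
      then have "b = B * (2 powr - (1 + real k))"
        by (simp add: b_def)
      then have "b powr (- (q * \<theta>)) = B powr (- (q * \<theta>)) * (2 powr - (1 + real k)) powr (- (q * \<theta>))"
        using assms by (simp add: powr_mult)
      also have "(2 powr - (1 + real k)) powr (- (q * \<theta>)) = 2 powr (q * \<theta> + q * \<theta> * real k)"
        unfolding powr_powr by (simp add: algebra_simps)
      also have "\<dots> = 2 powr (q * \<theta>) * (2 powr (q * \<theta>)) ^ k"
        by (simp add: powr_add powr_power mult_ac)
      finally show ?thesis by simp
    qed
    also have "weak_const A r * (B / 2 ^ k * (B powr (- (q * \<theta>)) * 2 powr (q * \<theta>) * (2 powr (q * \<theta>)) ^ k))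
      = a * z ^ k"
      using assms by (simp add: a_def z_def powr_diff powr_minus field_simps)
    finally show ?thesis .
  qed
  have "(\<integral>\<^sup>+x. ennreal (g x * h x) * indicator {x. g x \<le> B} x \<partial>M) \<le> (\<integral>\<^sup>+x. (\<Sum>k. \<phi> k x) \<partial>M)"
  proof (rule nn_integral_mono)
    fix x assume x: "x \<in> space M"
    show "ennreal (g x * h x) * indicator {x. g x \<le> B} x \<le> (\<Sum>k. \<phi> k x)"
    proof (cases "0 < g x \<and> g x \<le> B")
      \<comment> \<open>Points with \<open>g x = 0\<close> lie in no layer, but the integrand
        vanishes there.\<close>
      case False
      then have "ennreal (g x * h x) * indicator {x. g x \<le> B} x = 0"
        using g(2)[of x] by (cases "g x = 0") (auto simp: indicator_def)
      then show ?thesis by auto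
    next
      case True
      then have "1 \<le> B / g x" by simp
      then obtain j where "2 ^ j \<le> B / g x" "B / g x < 2 ^ Suc j"
        by (rule dyadic_interval)
      then have j: "g x \<le> B / 2 ^ j" "B / 2 ^ Suc j \<le> g x"
        using True by (simp_all add: field_simps)
      have "ennreal (g x * h x) * indicator {x. g x \<le> B} x \<le> \<phi> j x"
      proof -
        have "g x * h x \<le> B / 2 ^ j * h x"
          using j h(2) by (intro mult_right_mono) auto
        then show ?thesis
          using j x True h(2) assms by (auto simp: \<phi>_def E_def ennreal_mult[symmetric] intro!: ennreal_leI)
      qed
      also have "\<dots> \<le> (\<Sum>k. \<phi> k x)" by (rule suminf_ge_term_ennreal)
      finally show ?thesis .
    qed
  qed
  also have "\<dots> \<le> ennreal (a / (1 - z))"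
    using z a by (intro nn_integral_suminf_geometric_le \<phi>) auto
  also have "a / (1 - z) = weak_prod_const A q r * B powr (1 - q * (1 - 1 / r))"
    by (simp add: a_def z_def weak_prod_const_def \<theta>_def)
  finally show ?thesis .
qed

section \<open>The weak Young inequality\<close>

lemma distr_lborel_reflect: "distr lborel borel (\<lambda>y. x - y) = (lborel :: 'a::euclidean_space measure)"
  by (subst (2) lborel_affine[of "-1" x]) (auto simp: density_1)

lemma distr_lborel_translate: "distr lborel borel (\<lambda>x. x - y) = (lborel :: 'a::euclidean_space measure)"
  by (subst (2) lborel_affine[of 1 "- y"]) (auto simp: density_1)

lemma weak_bound_reflect:
  fixes h :: "'a::euclidean_space \<Rightarrow> real"
  assumes [measurable]: "h \<in> borel_measurable borel" and "weak_bound lborel h A r"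
  shows "weak_bound lborel (\<lambda>y. h (x - y)) A r"
proof -
  have "emeasure lborel {y. c \<le> h (x - y)} = emeasure (distr lborel borel (\<lambda>y. x - y)) {z. c \<le> h z}" for c
    by (subst emeasure_distr) (auto simp: vimage_def)
  with assms(2) show ?thesis by (simp add: weak_bound_def distr_lborel_reflect)
qed

lemma weak_bound_translate:
  fixes h :: "'a::euclidean_space \<Rightarrow> real"
  assumes [measurable]: "h \<in> borel_measurable borel" and "weak_bound lborel h A r"
  shows "weak_bound lborel (\<lambda>x. h (x - y)) A r"
proof -
  have "emeasure lborel {x. c \<le> h (x - y)} = emeasure (distr lborel borel (\<lambda>x. x - y)) {z. c \<le> h z}" for c
    by (subst emeasure_distr) (auto simp: vimage_def)
  with assms(2) show ?thesis by (simp add: weak_bound_def distr_lborel_translate)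
qed

lemma weak_bound_of_nn_integral:
  assumes "u \<in> borel_measurable M" "0 < p" "\<And>x. 0 \<le> u x"
    and "(\<integral>\<^sup>+x. ennreal (u x powr p) \<partial>M) \<le> 1"
  shows "weak_bound M u 1 p"
  using emeasure_superlevel_le_powr[of u M _ p 1] assms by (simp add: weak_bound_def)

text \<open>From \<open>1 / p < 1\<close> the relation leaves \<open>1 / q > 1 - 1 / r\<close>. This
  is the convergence condition of the descending dyadic sum.\<close>

lemma young_exponent_less_1:
  fixes p q r :: real
  assumes "1 < p" "1 < q" "1 / p + 1 / q + 1 / r = 2"
  shows "q * (1 - 1 / r) < 1"
proof -
  have "1 / p < 1" using assms by simp
  then have "1 - 1 / r < 1 / q" using assms by linarith
  then have "q * (1 - 1 / r) < q * (1 / q)" using assms by (intro mult_strict_left_mono) auto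
  then show ?thesis using assms by simp
qed

text \<open>The kernel is a general \<open>K x y\<close>, so that the same estimate serves both
  regions of the splitting, with the roles of the two variables exchanged.\<close>

lemma truncated_trilinear_le:
  fixes f :: "'a \<Rightarrow> real" and g :: "'b \<Rightarrow> real" and K :: "'a \<Rightarrow> 'b \<Rightarrow> real"
  assumes [measurable]: "f \<in> borel_measurable M" "g \<in> borel_measurable N" "\<And>x. K x \<in> borel_measurable N"
    and nonneg: "\<And>x. 0 \<le> f x" "\<And>y. 0 \<le> g y" "\<And>x y. 0 \<le> K x y"
    and K: "\<And>x. weak_bound N (K x) A r"
    and f: "(\<integral>\<^sup>+x. ennreal (f x powr p) \<partial>M) \<le> 1"
    and g: "weak_bound N g 1 q"
    and "0 \<le> A" "1 < p" "1 < q" "1 < r" and pqr: "1 / p + 1 / q + 1 / r = 2"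
  shows "(\<integral>\<^sup>+x. \<integral>\<^sup>+y. ennreal (f x * g y * K x y) * indicator {y. g y \<le> f x powr (p / q)} y \<partial>N \<partial>M)
    \<le> ennreal (weak_prod_const A q r)"
proof -
  define C where "C = weak_prod_const A q r"
  have \<theta>: "q * (1 - 1 / r) < 1"
    using assms by (intro young_exponent_less_1[of p]) auto
  have C: "0 \<le> C"
    using weak_prod_const_pos[of A r q] assms \<theta> by (simp add: C_def)
  have "(\<integral>\<^sup>+x. \<integral>\<^sup>+y. ennreal (f x * g y * K x y) * indicator {y. g y \<le> f x powr (p / q)} y \<partial>N \<partial>M)
    \<le> (\<integral>\<^sup>+x. ennreal C * ennreal (f x powr p) \<partial>M)"
  proof (rule nn_integral_mono)
    fix x
    show "(\<integral>\<^sup>+y. ennreal (f x * g y * K x y) * indicator {y. g y \<le> f x powr (p / q)} y \<partial>N)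
      \<le> ennreal C * ennreal (f x powr p)"
    proof (cases "f x = 0")
      case False
      then have fx: "0 < f x" using nonneg(1)[of x] by simp
      define B where "B = f x powr (p / q)"
      have B: "0 < B" using fx by (simp add: B_def)
      have "(\<integral>\<^sup>+y. ennreal (f x * g y * K x y) * indicator {y. g y \<le> B} y \<partial>N)
        = (\<integral>\<^sup>+y. ennreal (f x) * (ennreal (g y * K x y) * indicator {y. g y \<le> B} y) \<partial>N)"
        using nonneg by (intro nn_integral_cong) (simp add: ennreal_mult' mult.assoc)
      also have "\<dots> = ennreal (f x) * (\<integral>\<^sup>+y. ennreal (g y * K x y) * indicator {y. g y \<le> B} y \<partial>N)"
        by (rule nn_integral_cmult) measurable
      also have "\<dots> \<le> ennreal (f x) * ennreal (C * B powr (1 - q * (1 - 1 / r)))"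
        unfolding C_def using assms B \<theta>
        by (intro mult_left_mono weak_bound_nn_integral_truncated_le) auto
      also have "\<dots> = ennreal (f x * (C * B powr (1 - q * (1 - 1 / r))))"
        using fx by (simp add: ennreal_mult')
      also have "f x * (C * B powr (1 - q * (1 - 1 / r))) = C * f x powr p"
      \<comment> \<open>The truncation height \<open>f x powr (p / q)\<close> is chosen for this
        identity: the exponents of \<open>f x\<close> add up to
        \<open>p * (1 / p + 1 / q + 1 / r) - p\<close>, which is \<open>p\<close>.\<close>
      proof -
        have "1 + p / q * (1 - q * (1 - 1 / r)) = 1 + p * (1 / p + 1 / q + 1 / r) - p - 1"
          using assms by (simp add: field_simps)
        also have "\<dots> = p" using pqr by simp
        finally have "f x powr 1 * B powr (1 - q * (1 - 1 / r)) = f x powr p"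
          unfolding B_def powr_powr powr_add[symmetric] by simp
        then show ?thesis using fx by (simp add: mult.left_commute)
      qed
      finally show ?thesis using C by (simp add: B_def ennreal_mult)
    qed simp
  qed
  also have "\<dots> = ennreal C * (\<integral>\<^sup>+x. ennreal (f x powr p) \<partial>M)"
    by (rule nn_integral_cmult) measurable
  also have "\<dots> \<le> ennreal C * 1"
    by (intro mult_left_mono f) auto
  finally show ?thesis by (simp add: C_def)
qed

lemma weak_young_normalized:
  fixes f g h :: "'a::euclidean_space \<Rightarrow> real"
  assumes [measurable]: "f \<in> borel_measurable borel" "g \<in> borel_measurable borel" "h \<in> borel_measurable borel"
    and nonneg: "\<And>x. 0 \<le> f x" "\<And>x. 0 \<le> g x" "\<And>x. 0 \<le> h x"
    and h: "weak_bound lborel h A r"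
    and f: "(\<integral>\<^sup>+x. ennreal (f x powr p) \<partial>lborel) \<le> 1"
    and g: "(\<integral>\<^sup>+x. ennreal (g x powr q) \<partial>lborel) \<le> 1"
    and pqr: "0 \<le> A" "1 < p" "1 < q" "1 < r" "1 / p + 1 / q + 1 / r = 2"
  shows "(\<integral>\<^sup>+y. \<integral>\<^sup>+x. ennreal (f x * g y * h (x - y)) \<partial>lborel \<partial>lborel)
    \<le> ennreal (weak_prod_const A q r + weak_prod_const A p r)"
proof -
  let ?I = "\<lambda>x y. ennreal (f x * g y * h (x - y))"
  let ?F = "\<lambda>x y. ?I x y * indicator {y. g y \<le> f x powr (p / q)} y"
  let ?G = "\<lambda>y x. ennreal (g y * f x * h (x - y)) * indicator {x. f x \<le> g y powr (q / p)} x"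
  \<comment> \<open>Outside the first region, raising \<open>f x powr (p / q) < g y\<close> to the
    power \<open>q / p\<close> gives \<open>f x \<le> g y powr (q / p)\<close>. The two regions may
    overlap, so only an upper bound results.\<close>
  have split: "?I x y \<le> ?F x y + ?G y x" for x y
  proof (cases "g y \<le> f x powr (p / q)")
    case True
    then show ?thesis by (simp add: add_increasing2)
  next
    case False
    then have "(f x powr (p / q)) powr (q / p) \<le> g y powr (q / p)"
      using pqr by (intro powr_mono2) auto
    then have "f x \<le> g y powr (q / p)"
      using pqr nonneg(1)[of x] by (simp add: powr_powr)
    then show ?thesis by (simp add: add_increasing mult.commute)
  qed
  have "(\<integral>\<^sup>+y. \<integral>\<^sup>+x. ?I x y \<partial>lborel \<partial>lborel)
      \<le> (\<integral>\<^sup>+y. \<integral>\<^sup>+x. ?F x y + ?G y x \<partial>lborel \<partial>lborel)"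
    by (intro nn_integral_mono split)
  also have "\<dots> = (\<integral>\<^sup>+y. (\<integral>\<^sup>+x. ?F x y \<partial>lborel) + (\<integral>\<^sup>+x. ?G y x \<partial>lborel) \<partial>lborel)"
    by (intro nn_integral_cong nn_integral_add) measurable
  also have "\<dots> = (\<integral>\<^sup>+y. \<integral>\<^sup>+x. ?F x y \<partial>lborel \<partial>lborel) + (\<integral>\<^sup>+y. \<integral>\<^sup>+x. ?G y x \<partial>lborel \<partial>lborel)"
    by (intro nn_integral_add) measurable
  \<comment> \<open>The truncation of \<open>g\<close> requires the inner integral over
    \<open>y\<close>, so the order is exchanged for this region only.\<close>
  also have "(\<integral>\<^sup>+y. \<integral>\<^sup>+x. ?F x y \<partial>lborel \<partial>lborel) = (\<integral>\<^sup>+x. \<integral>\<^sup>+y. ?F x y \<partial>lborel \<partial>lborel)"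
    by (rule lborel_pair.Fubini') measurable
  also have "\<dots> \<le> ennreal (weak_prod_const A q r)"
    using assms
    by (intro truncated_trilinear_le[where K = "\<lambda>x y. h (x - y)"] weak_bound_reflect weak_bound_of_nn_integral) auto
  also have "(\<integral>\<^sup>+y. \<integral>\<^sup>+x. ?G y x \<partial>lborel \<partial>lborel) \<le> ennreal (weak_prod_const A p r)"
    using assms
    by (intro truncated_trilinear_le[where K = "\<lambda>y x. h (x - y)"] weak_bound_translate weak_bound_of_nn_integral) auto
  finally have le: "(\<integral>\<^sup>+y. \<integral>\<^sup>+x. ?I x y \<partial>lborel \<partial>lborel)
      \<le> ennreal (weak_prod_const A q r) + ennreal (weak_prod_const A p r)"
    by (auto intro: add_mono)
  have "q * (1 - 1 / r) < 1" "p * (1 - 1 / r) < 1"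
    using pqr young_exponent_less_1[of p q r] young_exponent_less_1[of q p r] by auto
  then have "0 \<le> weak_prod_const A q r" "0 \<le> weak_prod_const A p r"
    using weak_prod_const_pos[of A r] pqr by (auto intro: less_imp_le)
  with le show ?thesis by simp
qed

text \<open>Follows from the normalized case by bilinearity, applied to \<open>f / a\<close> and
  \<open>g / b\<close>. The numbers \<open>a\<close> and \<open>b\<close> are merely positive upper
  bounds of the norms, so functions of norm zero need no separate treatment.\<close>

lemma weak_young:
  fixes f g h :: "'a::euclidean_space \<Rightarrow> real"
  assumes [measurable]: "f \<in> borel_measurable borel" "g \<in> borel_measurable borel" "h \<in> borel_measurable borel"
    and nonneg: "\<And>x. 0 \<le> f x" "\<And>x. 0 \<le> g x" "\<And>x. 0 \<le> h x"
    and h: "weak_bound lborel h A r"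
    and f: "(\<integral>\<^sup>+x. ennreal (f x powr p) \<partial>lborel) \<le> ennreal (a powr p)" "0 < a"
    and g: "(\<integral>\<^sup>+x. ennreal (g x powr q) \<partial>lborel) \<le> ennreal (b powr q)" "0 < b"
    and pqr: "0 \<le> A" "1 < p" "1 < q" "1 < r" "1 / p + 1 / q + 1 / r = 2"
  shows "(\<integral>\<^sup>+y. \<integral>\<^sup>+x. ennreal (f x * g y * h (x - y)) \<partial>lborel \<partial>lborel)
    \<le> ennreal ((weak_prod_const A q r + weak_prod_const A p r) * a * b)"
proof -
  have scale: "(\<integral>\<^sup>+x. ennreal ((u x / c) powr t) \<partial>lborel) \<le> 1"
    if [measurable]: "u \<in> borel_measurable borel" and "(\<integral>\<^sup>+x. ennreal (u x powr t) \<partial>lborel) \<le> ennreal (c powr t)"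
      "0 < c" "\<And>x. 0 \<le> u x"
    for u :: "'a \<Rightarrow> real" and c t
  proof -
    have "(\<integral>\<^sup>+x. ennreal ((u x / c) powr t) \<partial>lborel) = (\<integral>\<^sup>+x. ennreal (1 / c powr t) * ennreal (u x powr t) \<partial>lborel)"
      using that by (intro nn_integral_cong) (simp add: ennreal_mult[symmetric] powr_divide)
    also have "\<dots> = ennreal (1 / c powr t) * (\<integral>\<^sup>+x. ennreal (u x powr t) \<partial>lborel)"
      by (rule nn_integral_cmult) measurable
    also have "\<dots> \<le> ennreal (1 / c powr t) * ennreal (c powr t)"
      by (intro mult_left_mono that) auto
    also have "\<dots> = 1" using that by (simp add: ennreal_mult[symmetric])
    finally show ?thesis .
  qed
  let ?C = "weak_prod_const A q r + weak_prod_const A p r"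
  let ?I = "\<lambda>x y. ennreal (f x / a * (g y / b) * h (x - y))"
  have "(\<integral>\<^sup>+y. \<integral>\<^sup>+x. ennreal (f x * g y * h (x - y)) \<partial>lborel \<partial>lborel)
      = (\<integral>\<^sup>+y. \<integral>\<^sup>+x. ennreal (a * b) * ?I x y \<partial>lborel \<partial>lborel)"
    using f g nonneg by (intro nn_integral_cong) (simp add: ennreal_mult[symmetric])
  also have "\<dots> = (\<integral>\<^sup>+y. ennreal (a * b) * (\<integral>\<^sup>+x. ?I x y \<partial>lborel) \<partial>lborel)"
    by (intro nn_integral_cong nn_integral_cmult) measurable
  also have "\<dots> = ennreal (a * b) * (\<integral>\<^sup>+y. \<integral>\<^sup>+x. ?I x y \<partial>lborel \<partial>lborel)"
    by (intro nn_integral_cmult) measurable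
  also have "\<dots> \<le> ennreal (a * b) * ennreal ?C"
    using f g nonneg pqr h
    by (intro mult_left_mono weak_young_normalized scale) auto
  also have "\<dots> = ennreal (a * b * ?C)"
    using f g by (simp add: ennreal_mult')
  also have "a * b * ?C = ?C * a * b" by simp
  finally show ?thesis .
qed

section \<open>Polar decomposition of homogeneous kernels\<close>

lemma borel_measurable_sgn [measurable]: "(sgn :: 'a::euclidean_space \<Rightarrow> 'a) \<in> borel_measurable borel"
  unfolding sgn_div_norm by measurable

lemma sets_sphere_measure_iff:
  "A \<in> sets sphere_measure \<longleftrightarrow> A \<in> sets borel \<and> A \<subseteq> sphere (0::'a::euclidean_space) 1"
  by (auto simp: sets_sphere_measure sets_restrict_space_iff)

lemma sets_cone_ball:
  assumes "A \<in> sets (sphere_measure :: 'a::euclidean_space measure)"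
  shows "{x \<in> ball 0 R. sgn x \<in> A} \<in> sets borel"
proof -
  have [measurable]: "A \<in> sets borel" using assms by (simp add: sets_sphere_measure_iff)
  show ?thesis by measurable
qed

text \<open>A cone of radius \<open>R\<close> is the dilation by \<open>R\<close> of the cone of
  radius 1, whose volume defines the spherical measure. This is all that is used of polar
  coordinates.\<close>

lemma emeasure_cone_ball:
  fixes A :: "'a::euclidean_space set"
  assumes A: "A \<in> sets sphere_measure" and R: "0 < R"
  shows "emeasure lborel {x \<in> ball 0 R. sgn x \<in> A}
    = ennreal (unit_ball_vol DIM('a) * R ^ DIM('a)) * emeasure sphere_measure A"
proof -
  let ?K = "\<lambda>R. {x \<in> ball 0 R. sgn x \<in> A}"
  let ?V = "unit_ball_vol (real DIM('a))"
  have V: "0 < ?V" by simp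
  have "emeasure sphere_measure A = emeasure lborel (?K 1) / ennreal ?V"
    using emeasure_sphere_measure[OF A] emeasure_ball[of 1 "0::'a"] by simp
  moreover have "ennreal ?V \<noteq> 0"
    using V by (metis ennreal_eq_0_iff not_le)
  ultimately have K1: "ennreal ?V * emeasure sphere_measure A = emeasure lborel (?K 1)"
    by (simp add: ennreal_times_divide mult.commute[of "ennreal ?V"] ennreal_mult_divide_eq)
  have KR: "emeasure lborel (?K R) = ennreal (R ^ DIM('a)) * emeasure lborel (?K 1)"
  proof -
    have "emeasure lborel (?K R)
        = emeasure (density (distr lborel borel (\<lambda>x. 0 + R *\<^sub>R x)) (\<lambda>_. ennreal (\<bar>R\<bar> ^ DIM('a)))) (?K R)"
      using R by (subst lborel_affine[of R 0]) auto
    also have "\<dots> = ennreal (R ^ DIM('a)) * emeasure (distr lborel borel (\<lambda>x. R *\<^sub>R x)) (?K R)"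
      using R sets_cone_ball[OF A, of R] by (subst emeasure_density) (auto simp: nn_integral_cmult_indicator)
    also have "emeasure (distr lborel borel (\<lambda>x. R *\<^sub>R x)) (?K R) = emeasure lborel (?K 1)"
    proof -
      have "(\<lambda>x. R *\<^sub>R x) -` ?K R = ?K 1"
        using R by (auto simp: sgn_scaleR)
      then show ?thesis
        using sets_cone_ball[OF A, of R] by (subst emeasure_distr) auto
    qed
    finally show ?thesis .
  qed
  have "ennreal (?V * R ^ DIM('a)) = ennreal (R ^ DIM('a)) * ennreal ?V"
    using R by (simp add: ennreal_mult mult.commute)
  then show ?thesis
    by (simp only: KR K1 mult.assoc)
qed

text \<open>The cone over a null set of the sphere is a countable union of truncated cones, each of
  volume zero. The origin is excluded because \<open>sgn 0 = 0\<close> is not on the sphere.\<close>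

lemma AE_sphere_measure_imp_AE_sgn:
  assumes "AE x in sphere_measure. P x"
  shows "AE z in (lborel :: 'a::euclidean_space measure). z \<noteq> 0 \<longrightarrow> P (sgn z)"
proof -
  obtain N :: "'a set" where N: "\<And>x. x \<in> sphere 0 1 - N \<Longrightarrow> P x" "N \<in> null_sets sphere_measure"
    using AE_E3[OF assms] by (metis space_sphere_measure)
  have "{z \<in> ball 0 (real (Suc k)). sgn z \<in> N} \<in> null_sets lborel" for k
    using N(2) sets_cone_ball[of N "real (Suc k)"] emeasure_cone_ball[of N "real (Suc k)"]
    by (auto simp: null_sets_def simp del: of_nat_Suc)
  then have "(\<Union>k. {z \<in> ball 0 (real (Suc k)). sgn z \<in> N}) \<in> null_sets lborel"
    by (rule null_sets_UN)
  then have "AE z in lborel. z \<notin> (\<Union>k. {z \<in> ball 0 (real (Suc k)). sgn z \<in> N})"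
    by (rule AE_not_in)
  then show ?thesis
  proof eventually_elim
    case (elim z)
    obtain k where "norm z < real k" using reals_Archimedean2 by blast
    then have "norm z < real (Suc k)" by simp
    then have "sgn z \<notin> N" using elim by auto
    then show ?case using N(1)[of "sgn z"] by (auto simp: norm_sgn)
  qed
qed

text \<open>In a direction where \<open>w\<close> is less than \<open>t\<close>, the superlevel set
  at height \<open>c\<close> stays within radius \<open>(t / c) powr (1 / l)\<close>. Dyadic layers
  of \<open>w\<close> thus cover it by one ball and a sequence of truncated cones. Their volumes are
  at most a constant times \<open>c powr - r * 2 powr (k * (r - s))\<close>, summable because
  \<open>r < s\<close>.\<close>

lemma weak_bound_homogeneous_kernel:
  fixes w :: "'a::euclidean_space \<Rightarrow> real"
  assumes [measurable]: "w \<in> borel_measurable borel"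
    and w: "weak_bound sphere_measure w N s" and "0 \<le> N" "0 < l" "real DIM('a) / l < s"
  obtains A where "0 \<le> A" "weak_bound lborel (\<lambda>z. w (sgn z) / norm z powr l) A (real DIM('a) / l)"
proof -
  define n where "n = DIM('a)"
  define r where "r = real n / l"
  define V where "V = unit_ball_vol (real n)"
  have V: "0 < V" by (simp add: V_def)
  define u where "u = (2::real) powr (r - s)"
  have u: "0 < u" "u < 1"
    using assms two_powr_less_1[of "r - s"] by (auto simp: u_def r_def n_def)
  define a where "a = 2 powr r * V * N"
  have a: "0 \<le> a" using V assms by (simp add: a_def)
  \<comment> \<open>\<open>V\<close> comes from the ball that covers directions with
    \<open>w < 1\<close>, the quotient from the cones over the layers.\<close>
  define A where "A = V + a / (1 - u)"
  have "weak_bound lborel (\<lambda>z. w (sgn z) / norm z powr l) A r"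
    unfolding weak_bound_def
  proof (intro allI impI)
    fix c :: real assume c: "0 < c"
    define S where "S = {z \<in> space lborel. c \<le> w (sgn z) / norm z powr l}"
    \<comment> \<open>The radius at which the kernel drops to \<open>c\<close> in a direction where
      \<open>w\<close> has the value \<open>t\<close>.\<close>
    define R where "R t = (t / c) powr (1 / l)" for t
    have R_pos: "0 < R t" if "0 < t" for t using that c by (simp add: R_def)
    have R_pow: "R t ^ n = t powr r * c powr - r" if "0 < t" for t
      using that c by (simp add: R_def r_def powr_power powr_divide powr_minus field_simps)
    define E where "E k = {x \<in> space sphere_measure. 2 ^ k \<le> w x}" for k
    have [measurable]: "w \<in> borel_measurable sphere_measure"
      using measurable_restrict_space1[of w borel borel "sphere 0 1"]
      by (simp add: measurable_cong_sets[OF sets_sphere_measure refl])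
    have E [measurable]: "E k \<in> sets sphere_measure" for k
      unfolding E_def by measurable
    define F where "F k = {z \<in> ball 0 (R (2 ^ Suc k)). sgn z \<in> E k}" for k
    have F [measurable]: "F k \<in> sets borel" for k
      unfolding F_def by (rule sets_cone_ball[OF E])
    have S_sub: "S \<subseteq> ball 0 (R 1) \<union> (\<Union>k. F k)"
    proof
      fix z assume "z \<in> S"
      then have z: "c \<le> w (sgn z) / norm z powr l" by (simp add: S_def)
      \<comment> \<open>At the origin the quotient is a division by zero, hence 0, which is below
        \<open>c\<close>.\<close>
      then have z0: "z \<noteq> 0" using c by auto
      then have *: "norm z powr l \<le> w (sgn z) / c"
        using z c by (simp add: field_simps)
      have bound: "norm z < R t" if "w (sgn z) < t" for t
      proof -
        have "norm z powr l < t / c"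
          using * that c by (meson divide_strict_right_mono le_less_trans)
        then have "(norm z powr l) powr (1 / l) < (t / c) powr (1 / l)"
          using \<open>0 < l\<close> by (intro powr_less_mono2) auto
        then show ?thesis using \<open>0 < l\<close> by (simp add: R_def powr_powr)
      qed
      show "z \<in> ball 0 (R 1) \<union> (\<Union>k. F k)"
      proof (cases "w (sgn z) < 1")
        case True
        then show ?thesis using bound by simp
      next
        case False
        then obtain k where k: "2 ^ k \<le> w (sgn z)" "w (sgn z) < 2 ^ Suc k"
          using dyadic_interval[of "w (sgn z)"] by auto
        then have "z \<in> F k"
          using bound z0 by (auto simp: F_def E_def space_sphere_measure norm_sgn)
        then show ?thesis by blast
      qed
    qed
    have F_le: "emeasure lborel (F k) \<le> ennreal (a * c powr - r * u ^ k)" for k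
    proof -
      have "emeasure lborel (F k) = ennreal (V * R (2 ^ Suc k) ^ n) * emeasure sphere_measure (E k)"
        unfolding F_def V_def n_def by (rule emeasure_cone_ball[OF E R_pos]) simp
      also have "\<dots> \<le> ennreal (V * R (2 ^ Suc k) ^ n) * ennreal (N * (2 ^ k) powr - s)"
        using w by (intro mult_left_mono) (auto simp: weak_bound_def E_def)
      also have "\<dots> = ennreal (V * R (2 ^ Suc k) ^ n * (N * (2 ^ k) powr - s))"
        using V R_pos[of "2 ^ Suc k"] assms by (simp add: ennreal_mult)
      also have "V * R (2 ^ Suc k) ^ n * (N * (2 ^ k) powr - s) = a * c powr - r * u ^ k"
      proof -
        have "(2 ^ Suc k) powr r = 2 powr r * (2 powr r) ^ k"
          by (simp add: powr_mult powr_power powr_realpow[symmetric] powr_powr mult_ac)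
        moreover have "(2 ^ k) powr - s = (2 powr - s) ^ k"
          by (simp add: powr_power powr_realpow[symmetric] powr_powr mult_ac)
        moreover have "u ^ k = (2 powr r) ^ k * (2 powr - s) ^ k"
          by (simp add: u_def power_mult_distrib[symmetric] powr_add[symmetric])
        ultimately show ?thesis
          unfolding R_pow[of "2 ^ Suc k", simplified] by (subst R_pow) (simp_all add: a_def)
      qed
      finally show ?thesis .
    qed
    have "emeasure lborel S \<le> emeasure lborel (ball 0 (R 1) \<union> (\<Union>k. F k))"
      by (rule emeasure_mono[OF S_sub]) auto
    also have "\<dots> \<le> emeasure lborel (ball (0::'a) (R 1)) + emeasure lborel (\<Union>k. F k)"
      by (rule emeasure_subadditive) auto
    also have "\<dots> \<le> emeasure lborel (ball (0::'a) (R 1)) + (\<Sum>k. emeasure lborel (F k))"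
      by (intro add_left_mono emeasure_subadditive_countably) auto
    also have "\<dots> \<le> ennreal (V * c powr - r) + (\<Sum>k. ennreal (a * c powr - r * u ^ k))"
    proof (rule add_mono)
      have "emeasure lborel (ball (0::'a) (R 1)) = ennreal (V * R 1 ^ n)"
        unfolding V_def n_def by (rule emeasure_ball) (use R_pos[of 1] in simp)
      then show "emeasure lborel (ball (0::'a) (R 1)) \<le> ennreal (V * c powr - r)"
        by (simp add: R_pow)
      show "(\<Sum>k. emeasure lborel (F k)) \<le> (\<Sum>k. ennreal (a * c powr - r * u ^ k))"
        by (intro suminf_le F_le) auto
    qed
    also have "(\<Sum>k. ennreal (a * c powr - r * u ^ k)) = ennreal (\<Sum>k. a * c powr - r * u ^ k)"
      using a u by (intro suminf_ennreal2) (auto intro!: summable_mult summable_geometric)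
    also have "(\<Sum>k. a * c powr - r * u ^ k) = a * c powr - r / (1 - u)"
      using u by (simp add: suminf_mult summable_geometric suminf_geometric)
    also have "ennreal (V * c powr - r) + ennreal (a * c powr - r / (1 - u)) = ennreal (A * c powr - r)"
      using V a u by (subst ennreal_plus[symmetric]) (auto simp: A_def algebra_simps)
    finally show "emeasure lborel {z \<in> space lborel. c \<le> w (sgn z) / norm z powr l} \<le> ennreal (A * c powr - r)"
      by (simp add: S_def)
  qed
  moreover have "0 \<le> A" using V a u by (simp add: A_def)
  ultimately show ?thesis using that by (simp add: r_def n_def)
qed

section \<open>Borel representatives and exponents\<close>

lemma completion_ex_borel_measurable_complex:
  fixes f :: "'a \<Rightarrow> complex"
  assumes f: "f \<in> borel_measurable (completion M)"
  shows "\<exists>f'\<in>borel_measurable M. AE x in M. f x = f' x"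
proof -
  have "(\<lambda>x. Re (f x)) \<in> borel_measurable (completion M)" "(\<lambda>x. Im (f x)) \<in> borel_measurable (completion M)"
    using f by (simp_all add: borel_measurable_complex_iff)
  from this[THEN completion_ex_borel_measurable_real]
  obtain a b where ab: "a \<in> borel_measurable M" "AE x in M. Re (f x) = a x"
      "b \<in> borel_measurable M" "AE x in M. Im (f x) = b x"
    by (elim bexE)
  have "(\<lambda>x. Complex (a x) (b x)) \<in> borel_measurable M"
    using ab(1,3) by (simp add: borel_measurable_complex_iff)
  moreover have "AE x in M. f x = Complex (a x) (b x)"
    by (rule AE_mp[OF ab(2) AE_mp[OF ab(4)]]) (rule AE_I2, simp add: complex_eq_iff)
  ultimately show ?thesis by (intro bexI[of _ "\<lambda>x. Complex (a x) (b x)"])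
qed

text \<open>The preimages of a set under the two functions differ by a null set only, and
  completeness makes this harmless.\<close>

lemma (in complete_measure) measurable_AE_cong:
  assumes [measurable]: "g \<in> measurable M N" and "f \<in> space M \<rightarrow> space N" and ae: "AE x in M. f x = g x"
  shows "f \<in> measurable M N"
proof (rule measurableI)
  fix B assume [measurable]: "B \<in> sets N"
  show "f -` B \<inter> space M \<in> sets M"
  proof (rule in_sets_AE)
    show "AE x in M. x \<in> g -` B \<inter> space M \<longleftrightarrow> x \<in> f -` B \<inter> space M"
      using ae by eventually_elim auto
  qed auto
qed (use assms(2) in auto)

text \<open>No integrability is assumed, since the integral of a nonintegrable function is 0 by
  convention. Iterated integrals can therefore be bounded without examining their sections.\<close>

lemma norm_integral_le_nn_integral:
  fixes f :: "'a \<Rightarrow> 'b::{banach, second_countable_topology}"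
  shows "ennreal (norm (LINT x|M. f x)) \<le> (\<integral>\<^sup>+x. ennreal (norm (f x)) \<partial>M)"
  by (cases "integrable M f") (auto simp: integral_norm_bound_ennreal not_integrable_integral_eq)

text \<open>By Tonelli, a Borel subset of the product is null once almost all of its sections are.
  The lemma transports an almost everywhere property along the two projections and along the
  difference map.\<close>

lemma AE_lborel_pair:
  fixes T :: "'a::euclidean_space \<times> 'b::euclidean_space \<Rightarrow> 'c::euclidean_space"
  assumes T: "T \<in> borel_measurable borel" and P: "AE z in lborel. P z"
    and null: "\<And>N. N \<in> null_sets lborel \<Longrightarrow> AE x in lborel. AE y in lborel. T (x, y) \<notin> N"
  shows "AE v in lborel. P (T v)"
proof -
  \<comment> \<open>\<open>P\<close> need not be measurable, so its exceptional set is enlarged to a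
    Borel null set.\<close>
  obtain N where N: "\<And>z. z \<notin> N \<Longrightarrow> P z" "N \<in> null_sets lborel"
    using AE_E3[OF P] by auto
  then have "T -` (- N) \<in> sets borel"
    by (intro measurable_sets_borel[OF T]) auto
  then have "{v \<in> space (lborel \<Otimes>\<^sub>M lborel). T v \<notin> N} \<in> sets (lborel \<Otimes>\<^sub>M lborel)"
    unfolding lborel_prod by (simp add: vimage_def)
  then have "AE v in lborel \<Otimes>\<^sub>M lborel. T v \<notin> N"
    by (rule lborel_pair.AE_pair_measure) (rule null[OF N(2)])
  then show ?thesis
    unfolding lborel_prod by eventually_elim (rule N(1))
qed

lemma AE_lborel_reflect:
  fixes P :: "'a::euclidean_space \<Rightarrow> bool"
  assumes "AE z in lborel. P z"
  shows "AE y in lborel. P (x - y)"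
  by (rule AE_distrD[where M' = borel and P = P]) (simp, unfold distr_lborel_reflect, rule assms)

lemma AE_lborel_translate:
  fixes P :: "'a::euclidean_space \<Rightarrow> bool"
  assumes "AE z in lborel. P z"
  shows "AE x in lborel. P (x - y)"
  by (rule AE_distrD[where M' = borel and P = P]) (simp, unfold distr_lborel_translate, rule assms)

text \<open>Borel representatives make the integrand jointly measurable, as Tonelli's theorem
  requires, and keep the norm.\<close>

lemma Lp_space_borel_representative:
  fixes f :: "'a::euclidean_space \<Rightarrow> complex"
  assumes f: "f \<in> Lp_space (ereal p) lebesgue" and "0 < p"
  obtains f' where "f' \<in> borel_measurable borel" "AE x in lborel. f x = f' x"
    "(\<integral>\<^sup>+x. ennreal (norm (f' x) powr p) \<partial>lborel) = ennreal (Lp_norm p lebesgue f powr p)"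
proof -
  have f: "f \<in> borel_measurable lebesgue" "integrable lebesgue (\<lambda>x. norm (f x) powr p)"
    using f by (auto simp: Lp_space_def)
  obtain f' where f': "f' \<in> borel_measurable borel" "AE x in lborel. f x = f' x"
    using completion_ex_borel_measurable_complex[OF f(1)] by auto
  have "(\<integral>\<^sup>+x. ennreal (norm (f' x) powr p) \<partial>lborel) = (\<integral>\<^sup>+x. ennreal (norm (f x) powr p) \<partial>lborel)"
    using f'(2) by (intro nn_integral_cong_AE) auto
  also have "\<dots> = (\<integral>\<^sup>+x. ennreal (norm (f x) powr p) \<partial>lebesgue)"
    by (simp add: nn_integral_completion)
  also have "\<dots> = ennreal (LINT x|lebesgue. norm (f x) powr p)"
    by (rule nn_integral_eq_integral[OF f(2)]) auto
  also have "(LINT x|lebesgue. norm (f x) powr p) = Lp_norm p lebesgue f powr p"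
    using \<open>0 < p\<close> by (simp add: Lp_norm_def powr_powr)
  finally show ?thesis using f' that by blast
qed

text \<open>For finite \<open>s\<close> take \<open>t = s\<close> and apply Chebyshev's inequality.
  For \<open>s = \<infinity>\<close> the function is essentially bounded on a space of finite
  measure, so any larger exponent works, and \<open>r + 1\<close> is taken.\<close>

lemma Lp_space_weak_bound:
  fixes w :: "'a \<Rightarrow> complex"
  assumes [measurable]: "w \<in> borel_measurable M" and "finite_measure M"
    and \<Omega>: "\<Omega> \<in> Lp_space s (completion M)" "AE x in M. \<Omega> x = w x"
    and "ereal r < s" "0 < r"
  obtains N t where "0 \<le> N" "r < t" "weak_bound M (\<lambda>x. norm (w x)) N t"
proof -
  have "\<exists>t>r. (\<integral>\<^sup>+x. ennreal (norm (w x) powr t) \<partial>M) < \<infinity>"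
  proof (cases "s = \<infinity>")
    case True
    then obtain c where c: "AE x in completion M. norm (\<Omega> x) \<le> c"
      using \<Omega>(1) by (auto simp: Lp_space_def)
    then have "AE x in M. norm (w x) \<le> c"
      using \<Omega>(2) unfolding AE_completion_iff by eventually_elim auto
    then have "(\<integral>\<^sup>+x. ennreal (norm (w x) powr (r + 1)) \<partial>M) \<le> (\<integral>\<^sup>+x. ennreal (c powr (r + 1)) \<partial>M)"
      using \<open>0 < r\<close> by (intro nn_integral_mono_AE) (auto elim!: eventually_mono intro!: ennreal_leI powr_mono2)
    also have "\<dots> < \<infinity>"
      using finite_measure.emeasure_finite[OF assms(2), of "space M"]
      by (simp add: ennreal_mult_less_top less_top)
    finally show ?thesis by (intro exI[of _ "r + 1"]) auto
  next
    case False
    with assms obtain t where t: "s = ereal t" "r < t"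
      by (cases s) auto
    then have int: "integrable (completion M) (\<lambda>x. norm (\<Omega> x) powr t)"
      using \<Omega>(1) by (auto simp: Lp_space_def)
    have "(\<integral>\<^sup>+x. ennreal (norm (w x) powr t) \<partial>M) = (\<integral>\<^sup>+x. ennreal (norm (\<Omega> x) powr t) \<partial>M)"
      using \<Omega>(2) by (intro nn_integral_cong_AE) auto
    also have "\<dots> = (\<integral>\<^sup>+x. ennreal (norm (\<Omega> x) powr t) \<partial>completion M)"
      by (simp add: nn_integral_completion)
    also have "\<dots> < \<infinity>"
      using nn_integral_eq_integral[OF int] by simp
    finally show ?thesis using t by blast
  qed
  then obtain t where t: "r < t" "(\<integral>\<^sup>+x. ennreal (norm (w x) powr t) \<partial>M) < \<infinity>" by blast
  define N where "N = enn2real (\<integral>\<^sup>+x. ennreal (norm (w x) powr t) \<partial>M)"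
  have N: "0 \<le> N" "(\<integral>\<^sup>+x. ennreal (norm (w x) powr t) \<partial>M) = ennreal N"
    using t by (auto simp: N_def)
  have "weak_bound M (\<lambda>x. norm (w x)) N t"
    unfolding weak_bound_def using N t \<open>0 < r\<close>
    by (intro allI impI emeasure_superlevel_le_powr) auto
  with N t that show ?thesis by blast
qed

section \<open>A limiting argument and the relations between the exponents\<close>

lemma real_le_of_eps:
  fixes x C a b :: real
  assumes "\<And>e. 0 < e \<Longrightarrow> x \<le> C * (a + e) * (b + e)"
  shows "x \<le> C * a * b"
proof (rule tendsto_lowerbound)
  show "((\<lambda>e. C * (a + e) * (b + e)) \<longlongrightarrow> C * a * b) (at_right 0)"
    by (auto intro!: tendsto_eq_intros)
  show "\<forall>\<^sub>F e in at_right 0. x \<le> C * (a + e) * (b + e)"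
    using assms by (auto simp: eventually_at_filter)
qed simp

lemma ereal_one_divide: "1 / ereal t = (if t = 0 then \<infinity> else ereal (1 / t))"
  by (simp add: one_ereal_def)

text \<open>For finite \<open>s\<close>, \<open>1 / p\<close> and \<open>1 / q\<close> are both
  below \<open>1 / s'\<close>, so \<open>1 / r > 2 - 2 / s' = 2 / s > 1 / s\<close>. For
  \<open>s = \<infinity>\<close> the dual exponent is 1.\<close>

lemma less_of_dual_exponent:
  fixes s s' :: ereal and p q r :: real
  assumes "1 < s" "1 / s + 1 / s' = 1" "s' < ereal p" "s' < ereal q"
    and "1 / p + 1 / q + 1 / r = 2" "1 < r"
  shows "1 < p" "1 < q" "ereal r < s"
proof -
  have *: "1 < p \<and> 1 < q \<and> ereal r < s"
  proof (cases s)
    case PInf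
    have "1 / s' = 1" using assms(2) PInf by simp
    then have "s' = 1"
      by (cases s') (auto simp: ereal_one_divide one_ereal_def split: if_splits)
    then show ?thesis using assms PInf by (simp add: one_ereal_def)
  next
    case (real t)
    then have t: "1 < t" using assms(1) by (simp add: one_ereal_def)
    then have sum: "ereal (1 / t) + 1 / s' = ereal 1"
      using assms(2) by (simp only: real ereal_one_divide one_ereal_def) auto
    \<comment> \<open>An infinite \<open>s'\<close> would force \<open>1 / t = 1\<close>, and
      \<open>s' = 0\<close> would make the sum infinite.\<close>
    obtain t' where t': "s' = ereal t'" "1 / t + 1 / t' = 1"
    proof (cases s')
      case (real t')
      with sum have "1 / t + 1 / t' = 1"
        by (cases "t' = 0") (simp_all add: ereal_one_divide)
      with real that show ?thesis by blast
    qed (use sum t assms(3) in auto)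
    have "0 < 1 / t" "1 / t < 1" using t by auto
    then have "0 < 1 / t'" "1 / t' < 1" using t'(2) by linarith+
    then have "1 < t'" by (simp add: divide_less_eq split: if_splits)
    then have pq: "1 < p" "1 < q" "t' < p" "t' < q" using assms t' by auto
    then have "1 / p < 1 / t'" "1 / q < 1 / t'"
      using \<open>1 < t'\<close> by (auto intro!: divide_strict_left_mono)
    then have "1 / t < 1 / r" using t'(2) assms(5) \<open>0 < 1 / t\<close> by linarith
    then have "r < t" using t assms by (simp add: divide_less_eq)
    then show ?thesis using pq real by simp
  qed (use assms in auto)
  show "1 < p" "1 < q" "ereal r < s" using * by auto
qed

section \<open>The weak bound for the rough kernel and the transfer from Borel
  representatives\<close>

theorem theorem3p1:
  fixes \<Omega> :: "real ^ 'n \<Rightarrow> complex"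
    and s s' :: ereal
    and p q l :: real
  assumes "CARD('n) \<ge> 2"
    and "1 < s"
    and "1 / s + 1 / s' = 1"
    and "\<And>t x. t > 0 \<Longrightarrow> \<Omega> (t *\<^sub>R x) = \<Omega> x"
    and "\<Omega> \<in> Lp_space s (completion sphere_measure)"
    and "0 < l" and "l < real CARD('n)"
    and "s' < ereal p" and "s' < ereal q"
    and "1 / p + 1 / q + l / real CARD('n) = 2"
  shows "\<exists>C>0. \<forall>f \<in> Lp_space (ereal p) lebesgue. \<forall>g \<in> Lp_space (ereal q) lebesgue.
    integrable lebesgue
      (\<lambda>(x :: real ^ 'n, y :: real ^ 'n).
        \<Omega> (x - y) * f x * g y / complex_of_real (norm (x - y) powr l)) \<and>
    norm (LINT y|lebesgue. LINT x|lebesgue.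
        \<Omega> (x - y) * f x * g y / complex_of_real (norm (x - y) powr l))
      \<le> C * Lp_norm p lebesgue f * Lp_norm q lebesgue g"
proof -
  define r where "r = real CARD('n) / l"
  have r: "1 < r" and r_eq: "1 / r = l / real CARD('n)"
    using assms by (simp_all add: r_def)
  have pqr: "1 / p + 1 / q + 1 / r = 2" using assms r_eq by simp
  note exps = less_of_dual_exponent[OF assms(2,3,8,9) pqr r]
  have pq_pos: "0 < p" "0 < q" using exps by auto

  have \<Omega>_meas: "\<Omega> \<in> borel_measurable (completion sphere_measure)"
    using assms(5) by (simp add: Lp_space_def)
  obtain w0 where w0: "w0 \<in> borel_measurable sphere_measure" "AE x in sphere_measure. \<Omega> x = w0 x"
    using completion_ex_borel_measurable_complex[OF \<Omega>_meas] by auto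
  \<comment> \<open>Extension by zero off the sphere gives a Borel function on the whole space, so
    that \<open>w (sgn z)\<close> is Borel in \<open>z\<close>.\<close>
  define w where "w x = indicator (sphere 0 1) x *\<^sub>R w0 x" for x
  have "w0 \<in> borel_measurable (restrict_space borel (sphere 0 1))"
    using w0(1) measurable_cong_sets[OF sets_sphere_measure refl] by blast
  then have w [measurable]: "w \<in> borel_measurable borel"
    unfolding w_def by (subst (asm) borel_measurable_restrict_space_iff) auto
  have w_sphere [measurable]: "w \<in> borel_measurable sphere_measure"
    using measurable_restrict_space1[OF w] measurable_cong_sets[OF sets_sphere_measure refl] by blast
  have w_AE: "AE x in sphere_measure. \<Omega> x = w x"
    using w0(2) AE_space by eventually_elim (simp add: w_def space_sphere_measure)
  have "finite_measure (sphere_measure :: (real ^ 'n) measure)"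
    by (rule finite_measureI) (simp add: space_sphere_measure prob_sphere_measure)
  then obtain N t where N: "0 \<le> N" "r < t" "weak_bound sphere_measure (\<lambda>x. norm (w x)) N t"
    using Lp_space_weak_bound[OF w_sphere _ assms(5) w_AE exps(3)] r by auto
  define h where "h z = norm (w (sgn z)) / norm z powr l" for z
  have h [measurable]: "h \<in> borel_measurable borel" unfolding h_def by measurable
  have h_nonneg: "0 \<le> h z" for z by (simp add: h_def)
  obtain A where A: "0 \<le> A" "weak_bound lborel h A r"
    using weak_bound_homogeneous_kernel[of "\<lambda>x. norm (w x)" N t l] N assms(6)
    unfolding h_def r_def by auto

  have "AE z in lborel. z \<noteq> 0 \<longrightarrow> \<Omega> (sgn z) = w (sgn z)"
    by (rule AE_sphere_measure_imp_AE_sgn[OF w_AE])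
  \<comment> \<open>Homogeneity with the factor \<open>1 / norm z\<close> turns
    \<open>\<Omega> (sgn z)\<close> into \<open>\<Omega> z\<close> for nonzero
    \<open>z\<close>.\<close>
  then have \<Omega>_AE: "AE z in lborel. z = 0 \<or> \<Omega> z = w (sgn z)"
  proof eventually_elim
    case (elim z)
    then show ?case
      using assms(4)[of "inverse (norm z)" z] by (auto simp: sgn_div_norm)
  qed

  define C where "C = weak_prod_const A q r + weak_prod_const A p r"
  have "q * (1 - 1 / r) < 1" "p * (1 - 1 / r) < 1"
    using young_exponent_less_1[of p q r] young_exponent_less_1[of q p r] pqr exps by auto
  then have "0 < C"
    using weak_prod_const_pos[of A r] A r by (auto simp: C_def intro: add_pos_pos)
  moreover have "integrable lebesgue (\<lambda>(x, y). \<Omega> (x - y) * f x * g y / complex_of_real (norm (x - y) powr l)) \<and>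
      norm (LINT y|lebesgue. LINT x|lebesgue. \<Omega> (x - y) * f x * g y / complex_of_real (norm (x - y) powr l))
      \<le> C * Lp_norm p lebesgue f * Lp_norm q lebesgue g"
    if f: "f \<in> Lp_space (ereal p) lebesgue" and g: "g \<in> Lp_space (ereal q) lebesgue" for f g
  proof -
    define K where "K x y = \<Omega> (x - y) * f x * g y / complex_of_real (norm (x - y) powr l)" for x y
    let ?a = "Lp_norm p lebesgue f" and ?b = "Lp_norm q lebesgue g"
    have ab: "0 \<le> ?a" "0 \<le> ?b" by (simp_all add: Lp_norm_def)
    obtain f' where f' [measurable]: "f' \<in> borel_measurable borel" and f_AE: "AE x in lborel. f x = f' x"
      and f'_int: "(\<integral>\<^sup>+x. ennreal (norm (f' x) powr p) \<partial>lborel) = ennreal (?a powr p)"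
      by (rule Lp_space_borel_representative[OF f pq_pos(1)])
    obtain g' where g' [measurable]: "g' \<in> borel_measurable borel" and g_AE: "AE x in lborel. g x = g' x"
      and g'_int: "(\<integral>\<^sup>+x. ennreal (norm (g' x) powr q) \<partial>lborel) = ennreal (?b powr q)"
      by (rule Lp_space_borel_representative[OF g pq_pos(2)])
    define K' where "K' x y = w (sgn (x - y)) * f' x * g' y / complex_of_real (norm (x - y) powr l)" for x y
    have K'_norm: "norm (K' x y) = norm (f' x) * norm (g' y) * h (x - y)" for x y
      by (simp add: K'_def h_def norm_mult norm_divide)
    \<comment> \<open>On the diagonal both kernels are 0, because the denominator vanishes and
      division by zero gives 0.\<close>
    have K_eq: "K x y = K' x y" if "f x = f' x" "g y = g' y" "x - y = 0 \<or> \<Omega> (x - y) = w (sgn (x - y))" for x y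
      using that by (auto simp: K_def K'_def)

    let ?I = "\<integral>\<^sup>+y. \<integral>\<^sup>+x. ennreal (norm (K' x y)) \<partial>lborel \<partial>lborel"
    \<comment> \<open>Adding \<open>e\<close> keeps both bounds positive when a norm is zero;
      \<open>e\<close> tends to 0 at the end.\<close>
    have I_le: "?I \<le> ennreal (C * (?a + e) * (?b + e))" if "0 < e" for e
      unfolding K'_norm C_def
      using A r pqr exps ab that h_nonneg
      by (intro weak_young) (auto simp: f'_int g'_int intro!: ennreal_leI powr_mono2)

    have "(\<lambda>(x, y). K' x y) \<in> borel_measurable (borel \<Otimes>\<^sub>M borel)"
      unfolding K'_def by measurable
    then have K'_meas: "(\<lambda>(x, y). K' x y) \<in> borel_measurable lborel"
      by (simp add: borel_prod)
    have "AE v in lborel. f (fst v) = f' (fst v)"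
      by (rule AE_lborel_pair[OF _ f_AE])
        (auto intro: borel_measurable_continuous_onI linear_continuous_on bounded_linear_fst dest: AE_not_in)
    moreover have "AE v in lborel. g (snd v) = g' (snd v)"
      by (rule AE_lborel_pair[OF _ g_AE])
        (auto intro: borel_measurable_continuous_onI linear_continuous_on bounded_linear_snd dest: AE_not_in)
    moreover have "AE v in lborel. fst v - snd v = 0 \<or> \<Omega> (fst v - snd v) = w (sgn (fst v - snd v))"
    proof (rule AE_lborel_pair[where T = "\<lambda>v. fst v - snd v", OF _ \<Omega>_AE])
      show "(\<lambda>v. fst v - snd v) \<in> borel_measurable (borel :: ((real ^ 'n) \<times> (real ^ 'n)) measure)"
        by (intro borel_measurable_continuous_onI continuous_intros)
      \<comment> \<open>For fixed \<open>x\<close>, the reflection taking \<open>y\<close> to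
        \<open>x - y\<close> preserves Lebesgue measure.\<close>
      show "AE x in lborel. AE y in lborel. fst (x, y) - snd (x, y) \<notin> Z"
        if "Z \<in> null_sets lborel" for Z :: "(real ^ 'n) set"
        using AE_lborel_reflect[OF AE_not_in[OF that]] by simp
    qed
    ultimately have K_AE: "AE v in lborel. (case v of (x, y) \<Rightarrow> K x y) = (case v of (x, y) \<Rightarrow> K' x y)"
    proof eventually_elim
      case (elim v)
      show ?case using K_eq[OF elim] by (simp only: case_prod_beta)
    qed

    have "integrable lebesgue (\<lambda>(x, y). K x y)"
    proof (rule integrableI_bounded)
      show "(\<lambda>(x, y). K x y) \<in> borel_measurable lebesgue"
        by (rule completion.measurable_AE_cong[OF measurable_completion[OF K'_meas] _ AE_completion[OF K_AE]]) simp
      have "(\<integral>\<^sup>+v. ennreal (norm (case v of (x, y) \<Rightarrow> K x y)) \<partial>lebesgue)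
          = (\<integral>\<^sup>+v. ennreal (norm (case v of (x, y) \<Rightarrow> K x y)) \<partial>lborel)"
        by (rule nn_integral_completion)
      also have "\<dots> = (\<integral>\<^sup>+v. ennreal (norm (case v of (x, y) \<Rightarrow> K' x y)) \<partial>(lborel \<Otimes>\<^sub>M lborel))"
        unfolding lborel_prod using K_AE by (intro nn_integral_cong_AE) auto
      \<comment> \<open>Tonelli's theorem for the Borel version; finiteness then follows from the
        bound with \<open>e = 1\<close>.\<close>
      also have "\<dots> = ?I"
        using K'_meas by (subst lborel_pair.nn_integral_snd[symmetric]) (auto simp: lborel_prod borel_prod)
      also have "\<dots> < \<infinity>"
        using I_le[of 1] by (auto intro: le_less_trans)
      finally show "(\<integral>\<^sup>+v. ennreal (norm (case v of (x, y) \<Rightarrow> K x y)) \<partial>lebesgue) < \<infinity>" .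
    qed
    moreover have "norm (LINT y|lebesgue. LINT x|lebesgue. K x y) \<le> C * ?a * ?b"
    proof (rule real_le_of_eps)
      fix e :: real assume e: "0 < e"
      have "ennreal (norm (LINT y|lebesgue. LINT x|lebesgue. K x y))
          \<le> (\<integral>\<^sup>+y. ennreal (norm (LINT x|lebesgue. K x y)) \<partial>lebesgue)"
        by (rule norm_integral_le_nn_integral)
      also have "\<dots> \<le> (\<integral>\<^sup>+y. \<integral>\<^sup>+x. ennreal (norm (K x y)) \<partial>lebesgue \<partial>lebesgue)"
        by (intro nn_integral_mono norm_integral_le_nn_integral)
      also have "\<dots> = (\<integral>\<^sup>+y. \<integral>\<^sup>+x. ennreal (norm (K x y)) \<partial>lborel \<partial>lborel)"
        by (simp add: nn_integral_completion)
      also have "\<dots> = ?I"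
      \<comment> \<open>For each \<open>y\<close> with \<open>g y = g' y\<close>, the exceptional
        set of \<open>\<Omega>\<close> translated by \<open>y\<close> is still null in
        \<open>x\<close>, so the inner integrals agree.\<close>
      proof (rule nn_integral_cong_AE)
        show "AE y in lborel. (\<integral>\<^sup>+x. ennreal (norm (K x y)) \<partial>lborel) = (\<integral>\<^sup>+x. ennreal (norm (K' x y)) \<partial>lborel)"
          using g_AE
        proof eventually_elim
          case (elim y)
          have "AE x in lborel. K x y = K' x y"
            using f_AE AE_lborel_translate[OF \<Omega>_AE, of y]
            by eventually_elim (use elim K_eq in auto)
          then show ?case by (intro nn_integral_cong_AE) auto
        qed
      qed
      also have "\<dots> \<le> ennreal (C * (?a + e) * (?b + e))"
        by (rule I_le[OF e])
      finally show "norm (LINT y|lebesgue. LINT x|lebesgue. K x y) \<le> C * (?a + e) * (?b + e)"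
        using \<open>0 < C\<close> ab e by (subst (asm) ennreal_le_iff) auto
    qed
    ultimately show ?thesis by (simp add: K_def)
  qed
  ultimately show ?thesis by blast
qed

end
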